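(* For any $0\le\alpha\le\frac14$, any $c>0$ and any integer $n\ge 0$ with $0<q=\frac{c^2}{\chi_n^\alpha(c)}<\frac{3}{17}$, set $A^2=|\psi_{n,c}^{(\alpha)}(0)|^2+\frac{|(\psi_{n,c}^{(\alpha)})'(0)|^2}{\chi_n^\alpha(c)}$. Then $$\sup_{x\in[0,1]}\sqrt{(1-x^2)(1-qx^2)}\;\omega_\alpha(x)\,|\psi_{n,c}^{(\alpha)}(x)|^2\le A^2\le 2\alpha+1 .$$
   Context: Let $I=[-1,1]$ and $\omega_\alpha(x)=(1-x^2)^\alpha$. For $c>0$, consider the Sturm-Liouville operator $\mathcal L_c^{(\alpha)}f(x)=-\frac{1}{\omega_\alpha(x)}\frac{d}{dx}\left[\omega_\alpha(x)(1-x^2)f'(x)\right]+c^2x^2f(x)$ on $I$. Its eigenvalues are listed in increasing order as $\chi_0^\alpha(c)<\chi_1^\alpha(c)<\cdots$. The generalized prolate spheroidal wave function $\psi_{n,c}^{(\alpha)}$, $n\ge 0$, is the (real-valued) eigenfunction, bounded on $I$, of $\mathcal L_c^{(\alpha)}$ for the eigenvalue $\chi_n^\alpha(c)$, normalized by $\int_{-1}^1|\psi_{n,c}^{(\alpha)}(x)|^2\omega_\alpha(x)\,dx=1$. *)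

theory Defs
  imports "HOL-Analysis.Analysis"
begin

text \<open>
  Since \<open>0 powr 0 = 0\<close>, for \<open>\<alpha> = 0\<close> this weight has the value 0 instead of 1 at \<open>x = 1\<close> and
  \<open>x = -1\<close>. Below, the endpoints matter only under an integral or next to a factor that vanishes
  there.
\<close>

definition jacobi_weight :: "real \<Rightarrow> real \<Rightarrow> real" where
  "jacobi_weight \<alpha> x = (1 - x\<^sup>2) powr \<alpha>"

definition sturm_liouville_op :: "real \<Rightarrow> real \<Rightarrow> (real \<Rightarrow> real) \<Rightarrow> real \<Rightarrow> real" where
  "sturm_liouville_op \<alpha> c f x =
     - (1 / jacobi_weight \<alpha> x) * deriv (\<lambda>t. jacobi_weight \<alpha> t * (1 - t\<^sup>2) * deriv f t) x
     + c\<^sup>2 * x\<^sup>2 * f x"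

text \<open>
  The differential equation is singular at the endpoints, so it is imposed on the open interval
  only; for \<open>\<alpha> \<ge> 0\<close> boundedness is the boundary condition that selects the regular solution.
\<close>

definition bounded_eigenfunction :: "real \<Rightarrow> real \<Rightarrow> real \<Rightarrow> (real \<Rightarrow> real) \<Rightarrow> bool" where
  "bounded_eigenfunction \<alpha> c \<mu> f \<longleftrightarrow>
     f differentiable_on {-1<..<1} \<and>
     (\<lambda>t. jacobi_weight \<alpha> t * (1 - t\<^sup>2) * deriv f t) differentiable_on {-1<..<1} \<and>
     (\<forall>x\<in>{-1<..<1}. sturm_liouville_op \<alpha> c f x = \<mu> * f x) \<and>
     bounded (f ` {-1..1}) \<and>
     (\<exists>x\<in>{-1<..<1}. f x \<noteq> 0)"

definition eigenvalues :: "real \<Rightarrow> real \<Rightarrow> real set" where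
  "eigenvalues \<alpha> c = {\<mu>. \<exists>f. bounded_eigenfunction \<alpha> c \<mu> f}"

definition chi :: "real \<Rightarrow> real \<Rightarrow> nat \<Rightarrow> real" where
  "chi \<alpha> c = (THE s. strict_mono s \<and> range s = eigenvalues \<alpha> c)"

text \<open>
  A predicate rather than a function, because the normalization leaves the sign free.
\<close>

definition is_gpswf :: "real \<Rightarrow> real \<Rightarrow> nat \<Rightarrow> (real \<Rightarrow> real) \<Rightarrow> bool" where
  "is_gpswf \<alpha> c n \<psi> \<longleftrightarrow>
     bounded_eigenfunction \<alpha> c (chi \<alpha> c n) \<psi> \<and>
     ((\<lambda>x. \<bar>\<psi> x\<bar>\<^sup>2 * jacobi_weight \<alpha> x) has_integral 1) {-1..1}"

end

theory Submission
  imports Defs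
begin

text \<open>
  Write \<open>\<mu>\<close> for the eigenvalue, \<open>\<omega>\<close> for the weight, \<open>a = 1 - x\<^sup>2\<close> and \<open>b = 1 - q * x\<^sup>2\<close>. Since
  \<open>c\<^sup>2 = q * \<mu>\<close>, the eigenfunction \<open>y\<close> solves \<open>(\<omega> a y')' = - \<mu> \<omega> b y\<close> on the open interval. Each of the two
  inequalities comes from a quadratic form in \<open>y\<close> and \<open>y'\<close> that is monotone on \<open>[0, 1)\<close> and can be
  read off at 0.

  Pointwise bound. In the Liouville variable \<open>s\<close>, given by \<open>ds/dx = sqrt (b / a)\<close>, the
  function \<open>U = sqrt R * y\<close> with \<open>R = sqrt (a * b) * \<omega>\<close> satisfies \<open>U'' + (\<mu> + \<theta>) U = 0\<close> for an explicit
  rational function \<open>\<theta>\<close> of \<open>x\<^sup>2\<close>, where dashes on \<open>U\<close>, \<open>V\<close> and \<open>\<theta>\<close> stand for \<open>d/ds\<close>. The Sonin function \<open>V = U\<^sup>2 + U'\<^sup>2 / (\<mu> + \<theta>)\<close> has derivative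
  \<open>- \<theta>' U'\<^sup>2 / (\<mu> + \<theta>)\<^sup>2\<close>, so it decreases wherever \<open>\<theta>\<close> increases. The constraints on \<open>\<alpha>\<close> and \<open>q\<close> make
  \<open>\<theta>\<close> increasing on \<open>[0, 1)\<close> with \<open>\<theta> \<ge> 0\<close> at 0 (\<open>potential'_nonneg\<close>), whence
  \<open>R y\<^sup>2 = U\<^sup>2 \<le> V(x) \<le> V(0) \<le> A\<^sup>2\<close>. All of this is carried out in the original variable \<open>x\<close>, where \<open>V\<close>
  is called \<open>envelope\<close>, to avoid integrating \<open>ds/dx\<close>.

  Bound on \<open>A\<close>. The form \<open>E = (\<omega> a y')\<^sup>2 + \<mu> R\<^sup>2 y\<^sup>2\<close> has derivative \<open>\<mu> (R\<^sup>2)' y\<^sup>2\<close>, because the equation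
  cancels the cross terms, and \<open>- (R\<^sup>2)' \<le> (4 \<alpha> + 2) \<omega>\<close> on \<open>[0, 1)\<close>. Moreover \<open>E(0) = \<mu> A\<^sup>2\<close>, and \<open>E\<close>
  takes arbitrarily small values near 1, as a flux \<open>\<omega> a y'\<close> bounded away from 0 would make \<open>y\<close>
  diverge at least logarithmically. Integration over \<open>[0, 1]\<close> gives
  \<open>A\<^sup>2 \<le> (4 \<alpha> + 2) \<integral> y\<^sup>2 \<omega>\<close> (\<open>energy_le_mass\<close>). The reflected function \<open>y(-x)\<close> solves the same equation
  with the same \<open>A\<close>, so the integral over \<open>[-1, 0]\<close> obeys the same bound; adding the two and using the
  normalization yields \<open>2 A\<^sup>2 \<le> 4 \<alpha> + 2\<close>.
\<close>

section \<open>The weight\<close>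

lemma one_minus_square_pos: "-1 < x \<Longrightarrow> x < 1 \<Longrightarrow> 0 < 1 - (x::real)\<^sup>2"
  by (simp add: abs_square_less_1 abs_less_iff)

lemma jacobi_weight_pos: "-1 < x \<Longrightarrow> x < 1 \<Longrightarrow> 0 < jacobi_weight \<alpha> x"
  using one_minus_square_pos[of x] by (simp add: jacobi_weight_def)

lemma jacobi_weight_le_1:
  assumes "0 \<le> \<alpha>" "-1 < x" "x < 1"
  shows "jacobi_weight \<alpha> x \<le> 1"
  unfolding jacobi_weight_def
  using powr_mono2[of \<alpha> "1 - x\<^sup>2" 1] one_minus_square_pos[of x] assms by simp

lemma jacobi_weight_even: "jacobi_weight \<alpha> (- x) = jacobi_weight \<alpha> x"
  by (simp add: jacobi_weight_def)

lemma jacobi_weight_has_derivative: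
  assumes "-1 < x" "x < 1"
  shows "(jacobi_weight \<alpha> has_real_derivative (- 2 * \<alpha> * x / (1 - x\<^sup>2)) * jacobi_weight \<alpha> x) (at x)"
proof -
  have p: "0 < 1 - x\<^sup>2"
    using one_minus_square_pos assms by blast
  have e: "(1 - x\<^sup>2) powr (\<alpha> - 1) = (1 - x\<^sup>2) powr \<alpha> / (1 - x\<^sup>2)"
    using p by (simp add: powr_diff)
  have "((\<lambda>t. (1 - t\<^sup>2) powr \<alpha>) has_real_derivative
      \<alpha> * (1 - x\<^sup>2) powr (\<alpha> - 1) * (- (2 * x))) (at x)"
    using p by (auto intro!: derivative_eq_intros)
  then show ?thesis
    unfolding jacobi_weight_def e by (simp add: mult_ac)
qed

section \<open>Coefficients of the Liouville transform\<close>

definition amplitude :: "real \<Rightarrow> real \<Rightarrow> real \<Rightarrow> real" where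
  "amplitude \<alpha> q x = sqrt ((1 - x\<^sup>2) * (1 - q * x\<^sup>2)) * jacobi_weight \<alpha> x"

text \<open>
  The logarithmic derivative of the square root of the amplitude (see \<open>amplitude_has_derivative\<close>).
\<close>
definition log_slope :: "real \<Rightarrow> real \<Rightarrow> real \<Rightarrow> real" where
  "log_slope \<alpha> q x = - x * ((\<alpha> + 1/2) / (1 - x\<^sup>2) + q / (2 * (1 - q * x\<^sup>2)))"

definition log_slope' :: "real \<Rightarrow> real \<Rightarrow> real \<Rightarrow> real" where
  "log_slope' \<alpha> q x = - ((\<alpha> + 1/2) / (1 - x\<^sup>2) + q / (2 * (1 - q * x\<^sup>2))
     + (2 * \<alpha> + 1) * x\<^sup>2 / (1 - x\<^sup>2)\<^sup>2 + q\<^sup>2 * x\<^sup>2 / (1 - q * x\<^sup>2)\<^sup>2)"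

text \<open>
  The square of \<open>dx/ds\<close>, where \<open>s\<close> is the Liouville variable.
\<close>
definition stretch :: "real \<Rightarrow> real \<Rightarrow> real" where
  "stretch q x = (1 - x\<^sup>2) / (1 - q * x\<^sup>2)"

text \<open>
  The potential \<open>\<theta>\<close> of the transformed equation as a function of \<open>t = x\<^sup>2\<close>, arranged so that its
  derivative in \<open>t\<close> is easy to estimate term by term; where it comes from is the content of
  \<open>potential_eq\<close>.
\<close>
definition potential :: "real \<Rightarrow> real \<Rightarrow> real \<Rightarrow> real" where
  "potential \<alpha> q t = (1/4 - \<alpha>\<^sup>2) * t / ((1 - t) * (1 - q * t)) + (\<alpha> + 1/2) / (1 - q * t)
     + q * (1 - 2 * t) / (2 * (1 - q * t)\<^sup>2) + 5/4 * q\<^sup>2 * t * (1 - t) / (1 - q * t)^3"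

definition potential' :: "real \<Rightarrow> real \<Rightarrow> real \<Rightarrow> real" where
  "potential' \<alpha> q t = (1/4 - \<alpha>\<^sup>2) * (1 - q * t\<^sup>2) / ((1 - t)\<^sup>2 * (1 - q * t)\<^sup>2)
     + (\<alpha> + 1/2) * q / (1 - q * t)\<^sup>2 - q * (1 - q + q * t) / (1 - q * t)^3
     + 5/4 * q\<^sup>2 * ((1 - 2 * t) * (1 - q * t) + 3 * q * t * (1 - t)) / (1 - q * t)^4"

lemma stretch_has_derivative:
  assumes "1 - q * x\<^sup>2 \<noteq> 0"
  shows "(stretch q has_real_derivative - 2 * x * (1 - q) / (1 - q * x\<^sup>2)\<^sup>2) (at x)"
  unfolding stretch_def
  apply (rule derivative_eq_intros refl assms)+
  using assms apply (simp add: divide_simps)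
  apply algebra
  done

lemma log_slope_has_derivative:
  assumes "1 - x\<^sup>2 \<noteq> 0" "1 - q * x\<^sup>2 \<noteq> 0"
  shows "(log_slope \<alpha> q has_real_derivative log_slope' \<alpha> q x) (at x)"
  unfolding log_slope_def log_slope'_def
  apply (rule derivative_eq_intros refl assms)+
  using assms apply simp_all
  apply (simp add: divide_simps)
  apply algebra
  done

lemma potential_has_derivative:
  assumes "1 - t \<noteq> 0" "1 - q * t \<noteq> 0"
  shows "(potential \<alpha> q has_real_derivative potential' \<alpha> q t) (at t)"
proof -
  have 1: "((\<lambda>t. t / ((1 - t) * (1 - q * t))) has_real_derivative
      (1 - q * t\<^sup>2) / ((1 - t)\<^sup>2 * (1 - q * t)\<^sup>2)) (at t)"
    apply (rule derivative_eq_intros refl assms)+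
    using assms apply simp_all
    apply (simp add: divide_simps)
    apply algebra
    done
  have 2: "((\<lambda>t. 1 / (1 - q * t)) has_real_derivative q / (1 - q * t)\<^sup>2) (at t)"
    apply (rule derivative_eq_intros refl assms)+
    using assms apply (simp_all add: divide_simps power2_eq_square)
    done
  have 3: "((\<lambda>t. (1 - 2 * t) / (2 * (1 - q * t)\<^sup>2)) has_real_derivative
      - ((1 - q + q * t) / (1 - q * t)^3)) (at t)"
    apply (rule derivative_eq_intros refl assms)+
    using assms apply simp_all
    apply (simp add: divide_simps)
    apply algebra
    done
  have 4: "((\<lambda>t. t * (1 - t) / (1 - q * t)^3) has_real_derivative
      ((1 - 2 * t) * (1 - q * t) + 3 * q * t * (1 - t)) / (1 - q * t)^4) (at t)"
    apply (rule derivative_eq_intros refl assms)+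
    using assms apply simp_all
    apply (simp add: divide_simps)
    apply algebra
    done
  have "((\<lambda>t. (1/4 - \<alpha>\<^sup>2) * (t / ((1 - t) * (1 - q * t))) + (\<alpha> + 1/2) * (1 / (1 - q * t))
     + q * ((1 - 2 * t) / (2 * (1 - q * t)\<^sup>2)) + 5/4 * q\<^sup>2 * (t * (1 - t) / (1 - q * t)^3))
     has_real_derivative
     (1/4 - \<alpha>\<^sup>2) * ((1 - q * t\<^sup>2) / ((1 - t)\<^sup>2 * (1 - q * t)\<^sup>2)) + (\<alpha> + 1/2) * (q / (1 - q * t)\<^sup>2)
     + q * - ((1 - q + q * t) / (1 - q * t)^3)
     + 5/4 * q\<^sup>2 * (((1 - 2 * t) * (1 - q * t) + 3 * q * t * (1 - t)) / (1 - q * t)^4)) (at t)"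
    by (intro DERIV_add DERIV_cmult 1 2 3 4)
  then show ?thesis
    unfolding potential_def[abs_def] potential'_def by (simp add: mult.assoc)
qed

lemma amplitude_has_derivative:
  assumes "-1 < x" "x < 1" "0 < 1 - q * x\<^sup>2"
  shows "(amplitude \<alpha> q has_real_derivative 2 * log_slope \<alpha> q x * amplitude \<alpha> q x) (at x)"
proof -
  have p: "0 < 1 - x\<^sup>2"
    using one_minus_square_pos assms by blast
  define S where "S = sqrt ((1 - x\<^sup>2) * (1 - q * x\<^sup>2))"
  have S: "S > 0" "S * S = (1 - x\<^sup>2) * (1 - q * x\<^sup>2)"
    using p assms(3) by (simp_all add: S_def)
  have "((\<lambda>t. (1 - t\<^sup>2) * (1 - q * t\<^sup>2)) has_real_derivative
      - 2 * x * (1 - q * x\<^sup>2) - 2 * q * x * (1 - x\<^sup>2)) (at x)"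
    by (auto intro!: derivative_eq_intros simp: algebra_simps power2_eq_square)
  from DERIV_chain2[where f = sqrt, OF DERIV_real_sqrt this]
  have "((\<lambda>t. sqrt ((1 - t\<^sup>2) * (1 - q * t\<^sup>2))) has_real_derivative
      inverse S / 2 * (- 2 * x * (1 - q * x\<^sup>2) - 2 * q * x * (1 - x\<^sup>2))) (at x)"
    unfolding S_def using p assms(3) by (metis mult_pos_pos)
  moreover have "inverse S / 2 * (- 2 * x * (1 - q * x\<^sup>2) - 2 * q * x * (1 - x\<^sup>2))
      = S * (- x / (1 - x\<^sup>2) - q * x / (1 - q * x\<^sup>2))"
  proof -
    have "S * (- x / (1 - x\<^sup>2) - q * x / (1 - q * x\<^sup>2))
        = (S * S) * (- x / (1 - x\<^sup>2) - q * x / (1 - q * x\<^sup>2)) / S"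
      using S(1) by simp
    also have "\<dots> = (- x * (1 - q * x\<^sup>2) - q * x * (1 - x\<^sup>2)) / S"
      unfolding S(2) using p assms(3) by (simp add: divide_simps)
    finally show ?thesis
      using S(1) by (simp add: divide_simps)
  qed
  ultimately have d: "((\<lambda>t. sqrt ((1 - t\<^sup>2) * (1 - q * t\<^sup>2))) has_real_derivative
      S * (- x / (1 - x\<^sup>2) - q * x / (1 - q * x\<^sup>2))) (at x)"
    by metis
  have e: "S * (- x / (1 - x\<^sup>2) - q * x / (1 - q * x\<^sup>2)) * jacobi_weight \<alpha> x
      + (- 2 * \<alpha> * x / (1 - x\<^sup>2)) * jacobi_weight \<alpha> x * S
      = 2 * log_slope \<alpha> q x * (S * jacobi_weight \<alpha> x)"
    unfolding log_slope_def using p assms(3) by (simp add: divide_simps) algebra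
  show ?thesis
    unfolding amplitude_def[abs_def]
    using DERIV_mult[OF d jacobi_weight_has_derivative[OF assms(1,2), of \<alpha>], folded S_def]
    unfolding e unfolding S_def .
qed

section \<open>Monotonicity of the potential\<close>

text \<open>
  Only \<open>- q * (1 - q + q * t) / (1 - q * t)^3\<close> and the factor \<open>1 - 2 * t\<close> can make the derivative
  negative. Bringing every term to the denominator \<open>(1 - q * t)^3\<close> reduces the claim to the polynomial
  inequality \<open>3/16 - q/2 + 9/4 * q\<^sup>2 - 4 * q\<^sup>2 * t \<ge> 0\<close>. Here \<open>3/16\<close> is the minimum of \<open>1/4 - \<alpha>\<^sup>2\<close> for
  \<open>0 \<le> \<alpha> \<le> 1/4\<close>, and the worst case \<open>t = 1\<close> still leaves room for \<open>q < 3/17\<close>.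
\<close>
lemma potential'_nonneg:
  assumes "0 \<le> \<alpha>" "\<alpha> \<le> 1/4" "0 < q" "q < 3/17" "0 \<le> t" "t < 1"
  shows "0 \<le> potential' \<alpha> q t"
proof -
  define a b where "a = 1 - t" and "b = 1 - q * t"
  have t: "0 \<le> q * t" "q * t \<le> q"
    using assms mult_left_mono[of t 1 q] by auto
  have ab: "0 < a" "a \<le> b" "0 < b"
    using assms t mult_right_mono[of q 1 t] by (auto simp: a_def b_def)
  have k: "3/16 \<le> 1/4 - \<alpha>\<^sup>2"
    using assms power_mono[of \<alpha> "1/4" 2] by (simp add: power2_eq_square)
  have "b \<le> 1 - q * t\<^sup>2"
    using mult_left_mono[of t 1 "q * t"] t assms by (simp add: b_def power2_eq_square)
  then have n: "0 \<le> 1 - q * t\<^sup>2" "b * a\<^sup>2 \<le> (1 - q * t\<^sup>2) * b\<^sup>2"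
    using ab by (auto intro!: mult_mono power_mono)
  \<comment> \<open>The first term is singular at \<open>t = 1\<close>; the estimate uses only \<open>a \<le> b \<le> 1 - q * t\<^sup>2\<close>.\<close>
  have 1: "3/16 / b^3 \<le> (1/4 - \<alpha>\<^sup>2) * (1 - q * t\<^sup>2) / (a\<^sup>2 * b\<^sup>2)"
  proof -
    have "a\<^sup>2 * b\<^sup>2 \<le> (1 - q * t\<^sup>2) * b^3"
      using mult_left_mono[OF n(2), of b] ab by (simp add: power2_eq_square power3_eq_cube mult_ac)
    then have "1 / b^3 \<le> (1 - q * t\<^sup>2) / (a\<^sup>2 * b\<^sup>2)"
      using ab by (simp add: pos_divide_le_eq pos_le_divide_eq)
    then have "3/16 * (1 / b^3) \<le> (1/4 - \<alpha>\<^sup>2) * ((1 - q * t\<^sup>2) / (a\<^sup>2 * b\<^sup>2))"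
      using k n ab by (intro mult_mono) auto
    then show ?thesis by simp
  qed
  have 2: "1/2 * q * b / b^3 \<le> (\<alpha> + 1/2) * q / b\<^sup>2"
    using assms ab by (simp add: divide_simps power2_eq_square power3_eq_cube)
  have 3: "5/4 * q\<^sup>2 * (1 - 2 * t) / b^3
      \<le> 5/4 * q\<^sup>2 * ((1 - 2 * t) * b + 3 * q * t * a) / b^4"
  proof -
    have "5/4 * q\<^sup>2 * (1 - 2 * t) / b^3 = 5/4 * q\<^sup>2 * ((1 - 2 * t) * b) / b^4"
      using ab by (simp add: power3_eq_cube power4_eq_xxxx)
    also have "\<dots> \<le> 5/4 * q\<^sup>2 * ((1 - 2 * t) * b + 3 * q * t * a) / b^4"
      using ab assms by (intro divide_right_mono mult_left_mono) auto
    finally show ?thesis .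
  qed
  have "q * q \<le> 3/17 * (3/17)"
    using assms by (intro mult_mono) auto
  moreover have "q\<^sup>2 * t \<le> q\<^sup>2"
    using assms by (simp add: mult_left_le)
  moreover have "q\<^sup>2 \<ge> 0"
    by simp
  ultimately have "0 \<le> 3/16 - q/2 + 9/4 * q\<^sup>2 - 4 * (q\<^sup>2 * t)"
    using assms unfolding power2_eq_square by linarith
  also have "\<dots> = 3/16 + 1/2 * q * b - q * (1 - q + q * t) + 5/4 * q\<^sup>2 * (1 - 2 * t)"
    by (simp add: b_def field_simps power2_eq_square)
  finally have "0 \<le> (3/16 + 1/2 * q * b - q * (1 - q + q * t) + 5/4 * q\<^sup>2 * (1 - 2 * t)) / b^3"
    using ab by simp
  also have "\<dots> = 3/16 / b^3 + 1/2 * q * b / b^3 - q * (1 - q + q * t) / b^3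
      + 5/4 * q\<^sup>2 * (1 - 2 * t) / b^3"
    by (simp add: add_divide_distrib diff_divide_distrib)
  also have "\<dots> \<le> potential' \<alpha> q t"
    using 1 2 3 unfolding potential'_def a_def b_def by linarith
  finally show ?thesis .
qed

lemma potential_nonneg:
  assumes "0 \<le> \<alpha>" "\<alpha> \<le> 1/4" "0 < q" "q < 3/17" "0 \<le> t" "t < 1"
  shows "0 \<le> potential \<alpha> q t"
proof -
  have "potential \<alpha> q 0 \<le> potential \<alpha> q t"
  proof (rule DERIV_nonneg_imp_nondecreasing[OF \<open>0 \<le> t\<close>])
    fix s assume s: "0 \<le> s" "s \<le> t"
    then have "q * s < 1 * 1"
      using assms by (intro mult_strict_mono') auto
    then have "(potential \<alpha> q has_real_derivative potential' \<alpha> q s) (at s)"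
      using s assms by (intro potential_has_derivative) auto
    then show "\<exists>d. (potential \<alpha> q has_real_derivative d) (at s) \<and> 0 \<le> d"
      using potential'_nonneg[of \<alpha> q s] s assms by auto
  qed
  moreover have "0 \<le> potential \<alpha> q 0"
    using assms by (simp add: potential_def)
  ultimately show ?thesis by simp
qed

text \<open>
  The Liouville variable and the amplitude are chosen so that the transformed equation has no first
  order term. This identity is that fact: it makes the coefficient of \<open>y'\<close> vanish in \<open>envelope_deriv\<close>.
\<close>
lemma stretch_friction_balance:
  assumes "1 - x\<^sup>2 \<noteq> 0" "1 - q * x\<^sup>2 \<noteq> 0"
  shows "4 * log_slope \<alpha> q x * stretch q x - 2 * x * (1 - q) / (1 - q * x\<^sup>2)\<^sup>2
     + 2 * stretch q x * ((2 * \<alpha> + 2) * x / (1 - x\<^sup>2)) = 0"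
  unfolding log_slope_def stretch_def
  using assms by (simp add: divide_simps) algebra

text \<open>
  The right-hand side is \<open>- u''/u\<close> for \<open>u = sqrt (amplitude)\<close>, with the dashes denoting derivatives
  with respect to the Liouville variable \<open>s\<close>: indeed \<open>(du/ds)/u = sqrt (stretch) * log_slope\<close>. This is
  the potential that the change of unknown \<open>U = u * y\<close> creates. The partial fractions in the
  definition of \<open>potential\<close> arise from it through \<open>(1 - q * t) - q * (1 - t) = 1 - q\<close>.
\<close>
lemma potential_eq:
  assumes "1 - x\<^sup>2 \<noteq> 0" "1 - q * x\<^sup>2 \<noteq> 0"
  shows "potential \<alpha> q (x\<^sup>2) = - (stretch q x * (log_slope \<alpha> q x)\<^sup>2
     - x * (1 - q) / (1 - q * x\<^sup>2)\<^sup>2 * log_slope \<alpha> q x + stretch q x * log_slope' \<alpha> q x)"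
  using assms
  unfolding potential_def log_slope_def log_slope'_def stretch_def
  apply (simp add: divide_simps)
  apply algebra
  done

section \<open>Bounded solutions of the Sturm-Liouville equation\<close>

text \<open>
  The function \<open>z\<close> is the derivative of \<open>y\<close>. Naming both makes the hypotheses invariant under
  \<open>x \<mapsto> - x\<close>, which exchanges the two endpoints.
\<close>
locale regular_solution =
  fixes \<alpha> q \<mu> :: real and y z :: "real \<Rightarrow> real"
  assumes alpha_bounds: "0 \<le> \<alpha>" "\<alpha> \<le> 1/4"
    and q_bounds: "0 < q" "q < 3/17"
    and mu_pos: "0 < \<mu>"
    and y_deriv: "\<And>x. -1 < x \<Longrightarrow> x < 1 \<Longrightarrow> (y has_real_derivative z x) (at x)"
    and flux_deriv: "\<And>x. -1 < x \<Longrightarrow> x < 1 \<Longrightarrow>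
      ((\<lambda>t. jacobi_weight \<alpha> t * (1 - t\<^sup>2) * z t) has_real_derivative
        - \<mu> * jacobi_weight \<alpha> x * (1 - q * x\<^sup>2) * y x) (at x)"
    and bounded: "\<exists>M. \<forall>x\<in>{-1<..<1}. \<bar>y x\<bar> \<le> M"
begin

lemma one_minus_q_square_pos: "-1 < x \<Longrightarrow> x < 1 \<Longrightarrow> 0 < 1 - q * x\<^sup>2"
  using one_minus_square_pos[of x] mult_strict_mono[of q 1 "x\<^sup>2" 1] q_bounds by simp

lemma reflection: "regular_solution \<alpha> q \<mu> (\<lambda>x. y (- x)) (\<lambda>x. - z (- x))"
proof (unfold_locales, goal_cases)
  case (6 x)
  then show ?case
    by (intro DERIV_mirror[THEN iffD1] y_deriv) auto
next
  case (7 x)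
  then have "((\<lambda>t. jacobi_weight \<alpha> (- t) * (1 - (- t)\<^sup>2) * z (- t)) has_real_derivative
      - (- \<mu> * jacobi_weight \<alpha> (- x) * (1 - q * (- x)\<^sup>2) * y (- x))) (at x)"
    using DERIV_mirror flux_deriv[of "- x"] by fastforce
  from DERIV_minus[OF this] show ?case
    by (simp add: jacobi_weight_even)
next
  case 8
  obtain M where "\<forall>x\<in>{-1<..<1}. \<bar>y x\<bar> \<le> M"
    using bounded by blast
  then show ?case
    by (intro exI[of _ M]) auto
qed (use alpha_bounds q_bounds mu_pos in auto)

lemma z_deriv:
  assumes "-1 < x" "x < 1"
  shows "(z has_real_derivative
    ((2 * \<alpha> + 2) * x * z x - \<mu> * (1 - q * x\<^sup>2) * y x) / (1 - x\<^sup>2)) (at x)"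
proof -
  define w where "w = jacobi_weight \<alpha> x"
  have p: "0 < 1 - x\<^sup>2" "0 < w"
    using assms one_minus_square_pos jacobi_weight_pos by (auto simp: w_def)
  have v: "((\<lambda>t. jacobi_weight \<alpha> t * (1 - t\<^sup>2)) has_real_derivative - (2 * \<alpha> + 2) * x * w) (at x)"
  proof -
    have "((\<lambda>t. jacobi_weight \<alpha> t * (1 - t\<^sup>2)) has_real_derivative
      (- 2 * \<alpha> * x / (1 - x\<^sup>2)) * w * (1 - x\<^sup>2) + (- (2 * x)) * w) (at x)"
      unfolding w_def
      by (intro DERIV_mult jacobi_weight_has_derivative assms) (auto intro!: derivative_eq_intros)
    moreover have "(- 2 * \<alpha> * x / (1 - x\<^sup>2)) * w * (1 - x\<^sup>2) + (- (2 * x)) * w = - (2 * \<alpha> + 2) * x * w"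
      using p by (simp add: divide_simps) (simp add: algebra_simps)
    ultimately show ?thesis
      by metis
  qed
  have "((\<lambda>t. (jacobi_weight \<alpha> t * (1 - t\<^sup>2) * z t) / (jacobi_weight \<alpha> t * (1 - t\<^sup>2)))
      has_real_derivative
      ((- \<mu> * w * (1 - q * x\<^sup>2) * y x) * (w * (1 - x\<^sup>2))
        - (w * (1 - x\<^sup>2) * z x) * (- (2 * \<alpha> + 2) * x * w))
      / ((w * (1 - x\<^sup>2)) * (w * (1 - x\<^sup>2)))) (at x)"
    using p DERIV_divide[OF flux_deriv[OF assms] v] by (simp add: w_def)
  then have "(z has_real_derivative
      ((- \<mu> * w * (1 - q * x\<^sup>2) * y x) * (w * (1 - x\<^sup>2))
        - (w * (1 - x\<^sup>2) * z x) * (- (2 * \<alpha> + 2) * x * w))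
      / ((w * (1 - x\<^sup>2)) * (w * (1 - x\<^sup>2)))) (at x)"
  proof (rule has_field_derivative_transform_within_open[where S = "{-1<..<1}"])
    fix t :: real
    assume "t \<in> {-1<..<1}"
    then show "jacobi_weight \<alpha> t * (1 - t\<^sup>2) * z t / (jacobi_weight \<alpha> t * (1 - t\<^sup>2)) = z t"
      using one_minus_square_pos[of t] jacobi_weight_pos[of t \<alpha>] by simp
  qed (use assms in auto)
  moreover have "((- \<mu> * w * (1 - q * x\<^sup>2) * y x) * (w * (1 - x\<^sup>2))
        - (w * (1 - x\<^sup>2) * z x) * (- (2 * \<alpha> + 2) * x * w))
      / ((w * (1 - x\<^sup>2)) * (w * (1 - x\<^sup>2)))
    = ((2 * \<alpha> + 2) * x * z x - \<mu> * (1 - q * x\<^sup>2) * y x) / (1 - x\<^sup>2)"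
    using p by (simp add: divide_simps) (simp add: algebra_simps)
  ultimately show ?thesis
    by metis
qed

subsection \<open>The envelope is nonincreasing\<close>

definition envelope :: "real \<Rightarrow> real" where
  "envelope x = amplitude \<alpha> q x * ((y x)\<^sup>2
     + stretch q x * (z x + log_slope \<alpha> q x * y x)\<^sup>2 / (\<mu> + potential \<alpha> q (x\<^sup>2)))"

text \<open>
  In the notation of the transformed equation this is
  \<open>dV/dx = - (d\<theta>/dx) (dU/ds)\<^sup>2 / (\<mu> + \<theta>)\<^sup>2\<close>, since
  \<open>(dU/ds)\<^sup>2 = amplitude * stretch * (z + log_slope * y)\<^sup>2\<close>.
\<close>
lemma envelope_deriv:
  assumes "0 \<le> x" "x < 1"
  shows "(envelope has_real_derivative
      - (amplitude \<alpha> q x * stretch q x * (z x + log_slope \<alpha> q x * y x)\<^sup>2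
         * (2 * x * potential' \<alpha> q (x\<^sup>2)) / (\<mu> + potential \<alpha> q (x\<^sup>2))\<^sup>2)) (at x)"
proof -
  have x: "-1 < x" "x < 1"
    using assms by auto
  define a b where ab: "a = 1 - x\<^sup>2" "b = 1 - q * x\<^sup>2"
  have pos: "0 < a" "0 < b"
    using one_minus_square_pos one_minus_q_square_pos x by (auto simp: ab)
  then have nz: "1 - x\<^sup>2 \<noteq> 0" "1 - q * x\<^sup>2 \<noteq> 0" "0 < 1 - q * x\<^sup>2"
    by (auto simp: ab)
  define R D h h' e N N' Y Z Z' D' W W' where
    defs: "R = amplitude \<alpha> q x" "D = stretch q x" "h = log_slope \<alpha> q x" "h' = log_slope' \<alpha> q x"
    "e = (2 * \<alpha> + 2) * x / a" "N = \<mu> + potential \<alpha> q (x\<^sup>2)" "N' = 2 * x * potential' \<alpha> q (x\<^sup>2)"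
    "Y = y x" "Z = z x" "Z' = e * Z - \<mu> * (b / a) * Y" "D' = - 2 * x * (1 - q) / b\<^sup>2"
    "W = Z + h * Y" "W' = Z' + (h' * Y + Z * h)"
  have N: "N > 0"
    using potential_nonneg[of \<alpha> q "x\<^sup>2"] alpha_bounds q_bounds mu_pos pos by (simp add: defs ab)
  have zd: "(z has_real_derivative Z') (at x)"
  proof -
    have "Z' = ((2 * \<alpha> + 2) * x * z x - \<mu> * (1 - q * x\<^sup>2) * y x) / (1 - x\<^sup>2)"
      using nz(1) by (simp add: defs ab divide_simps)
    then show ?thesis
      using z_deriv[OF x] by simp
  qed
  have Wd: "((\<lambda>x. z x + log_slope \<alpha> q x * y x) has_real_derivative W') (at x)"
    using DERIV_add[OF zd DERIV_mult[OF log_slope_has_derivative[OF nz(1,2), of \<alpha>] y_deriv[OF x]]]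
    unfolding defs(4)[symmetric] by (simp add: defs(3,8,9,13))
  have W2d: "((\<lambda>x. (z x + log_slope \<alpha> q x * y x)\<^sup>2) has_real_derivative 2 * (W' * W)) (at x)"
    using DERIV_power[OF Wd, of 2] by (simp add: defs(3,8,9,12))
  have Dd: "(stretch q has_real_derivative D') (at x)"
    using stretch_has_derivative[OF nz(2)] by (simp add: defs ab)
  have Nd: "((\<lambda>x. \<mu> + potential \<alpha> q (x\<^sup>2)) has_real_derivative N') (at x)"
  proof -
    have "((\<lambda>x. potential \<alpha> q (x\<^sup>2)) has_real_derivative potential' \<alpha> q (x\<^sup>2) * (2 * x)) (at x)"
      using nz by (intro DERIV_chain2[where f = "potential \<alpha> q", OF potential_has_derivative])
        (auto intro!: derivative_eq_intros)
    from DERIV_add[OF DERIV_const this, of \<mu>] show ?thesis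
      by (simp add: defs mult_ac)
  qed
  have y2d: "((\<lambda>x. (y x)\<^sup>2) has_real_derivative 2 * (Z * Y)) (at x)"
    using DERIV_power[OF y_deriv[OF x], of 2] by (simp add: defs)
  have Rd: "(amplitude \<alpha> q has_real_derivative 2 * h * R) (at x)"
    using amplitude_has_derivative[OF x nz(3)] by (simp add: defs)
  \<comment> \<open>This is \<open>d\<^sup>2U/ds\<^sup>2 + N * U = 0\<close>, multiplied by twice the reciprocal of the square root of \<open>R\<close>.\<close>
  have balance: "2 * Y * N + (2 * h * D + D') * W + 2 * D * W' = 0"
  proof -
    have 1: "4 * h * D + D' + 2 * D * e = 0"
      using stretch_friction_balance[OF nz(1,2), of \<alpha>] by (simp add: defs ab)
    have 2: "N = \<mu> - (D * h\<^sup>2 + D' / 2 * h + D * h')"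
      using potential_eq[OF nz(1,2), of \<alpha>] by (simp add: defs ab)
    have 3: "D * (b / a) = 1"
      using pos by (simp add: defs stretch_def ab)
    have "2 * Y * N + (2 * h * D + D') * W + 2 * D * W'
        = Z * (4 * h * D + D' + 2 * D * e) + 2 * Y * \<mu> * (1 - D * (b / a))"
      unfolding 2 defs(10,12,13) by (simp add: algebra_simps power2_eq_square)
    then show ?thesis
      unfolding 1 3 by simp
  qed
  have "(envelope has_real_derivative
      (2 * h * R) * (Y\<^sup>2 + D * W\<^sup>2 / N)
      + (2 * (Z * Y) + ((D' * W\<^sup>2 + 2 * (W' * W) * D) * N - D * W\<^sup>2 * N') / (N * N)) * R) (at x)"
    using DERIV_mult[OF Rd DERIV_add[OF y2d DERIV_divide[OF DERIV_mult[OF Dd W2d] Nd]]] N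
    unfolding envelope_def[abs_def] by (simp add: defs)
  moreover have "(2 * h * R) * (Y\<^sup>2 + D * W\<^sup>2 / N)
      + (2 * (Z * Y) + ((D' * W\<^sup>2 + 2 * (W' * W) * D) * N - D * W\<^sup>2 * N') / (N * N)) * R
      = - (R * D * W\<^sup>2 * N' / N\<^sup>2)"
  proof -
    have "(2 * h * R) * (Y\<^sup>2 + D * W\<^sup>2 / N)
      + (2 * (Z * Y) + ((D' * W\<^sup>2 + 2 * (W' * W) * D) * N - D * W\<^sup>2 * N') / (N * N)) * R
      = - (R * D * W\<^sup>2 * N' / N\<^sup>2)
        + R * W / N * (2 * Y * N + (2 * h * D + D') * W + 2 * D * W')
        + 2 * R * Y * (Z + h * Y - W)"
      using N by (simp add: field_simps power2_eq_square)
    also have "\<dots> = - (R * D * W\<^sup>2 * N' / N\<^sup>2)"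
      unfolding balance by (simp add: defs)
    finally show ?thesis .
  qed
  ultimately show ?thesis
    by (simp add: defs)
qed

text \<open>
  The left-hand side is the first summand of the envelope, whose value at 0 is the right-hand side with
  \<open>\<mu> + potential \<alpha> q 0\<close> in place of \<open>\<mu>\<close>, because the logarithmic slope vanishes there.
\<close>
lemma amplitude_square_le:
  assumes "0 \<le> x" "x < 1"
  shows "amplitude \<alpha> q x * (y x)\<^sup>2 \<le> (y 0)\<^sup>2 + (z 0)\<^sup>2 / \<mu>"
proof -
  have p: "0 < 1 - x\<^sup>2" "0 < 1 - q * x\<^sup>2" if "0 \<le> x" "x < 1" for x :: real
    using one_minus_square_pos[of x] one_minus_q_square_pos[of x] that by auto
  have N: "0 < \<mu> + potential \<alpha> q (x\<^sup>2)" if "0 \<le> x" "x < 1" for x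
    using potential_nonneg[of \<alpha> q "x\<^sup>2"] alpha_bounds q_bounds mu_pos p[OF that] by simp
  have R: "0 < amplitude \<alpha> q x" if "0 \<le> x" "x < 1" for x
    unfolding amplitude_def using p[OF that] jacobi_weight_pos[of x \<alpha>] that by simp
  have D: "0 < stretch q x" if "0 \<le> x" "x < 1" for x
    unfolding stretch_def using p[OF that] by simp
  have "amplitude \<alpha> q x * (y x)\<^sup>2 \<le> envelope x"
    unfolding envelope_def using R[OF assms] D[OF assms] N[OF assms] by simp
  also have "envelope x \<le> envelope 0"
  proof (rule DERIV_nonpos_imp_nonincreasing[OF assms(1)])
    fix s assume "0 \<le> s" "s \<le> x"
    then have s: "0 \<le> s" "s < 1"
      using assms by auto
    have "0 \<le> potential' \<alpha> q (s\<^sup>2)"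
      using potential'_nonneg[of \<alpha> q "s\<^sup>2"] p[OF s] alpha_bounds q_bounds by simp
    then have "0 \<le> amplitude \<alpha> q s * stretch q s * (z s + log_slope \<alpha> q s * y s)\<^sup>2
         * (2 * s * potential' \<alpha> q (s\<^sup>2)) / (\<mu> + potential \<alpha> q (s\<^sup>2))\<^sup>2"
      using R[OF s] D[OF s] s by simp
    then show "\<exists>d. (envelope has_real_derivative d) (at s) \<and> d \<le> 0"
      using envelope_deriv[OF s] by (metis neg_le_0_iff_le)
  qed
  also have "envelope 0 = (y 0)\<^sup>2 + (z 0)\<^sup>2 / (\<mu> + potential \<alpha> q 0)"
    by (simp add: envelope_def amplitude_def stretch_def log_slope_def jacobi_weight_def)
  also have "\<dots> \<le> (y 0)\<^sup>2 + (z 0)\<^sup>2 / \<mu>"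
    using potential_nonneg[of \<alpha> q 0] alpha_bounds q_bounds mu_pos by (simp add: frac_le)
  finally show ?thesis .
qed

subsection \<open>The energy is controlled by the weighted mass\<close>

definition energy :: "real \<Rightarrow> real" where
  "energy x = (jacobi_weight \<alpha> x * (1 - x\<^sup>2) * z x)\<^sup>2 + \<mu> * (amplitude \<alpha> q x)\<^sup>2 * (y x)\<^sup>2"

text \<open>
  The cross terms in \<open>y * z\<close> cancel because \<open>amplitude\<^sup>2\<close> is the product of the two coefficients
  \<open>\<omega> * (1 - x\<^sup>2)\<close> and \<open>\<omega> * (1 - q * x\<^sup>2)\<close> of the equation.
\<close>
lemma energy_deriv:
  assumes "-1 < x" "x < 1"
  shows "(energy has_real_derivative
    - (2 * \<mu> * x * ((2 * \<alpha> + 1) * (1 - q * x\<^sup>2) + q * (1 - x\<^sup>2)) * (jacobi_weight \<alpha> x)\<^sup>2 * (y x)\<^sup>2)) (at x)"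
proof -
  have p: "0 < 1 - x\<^sup>2" "0 < 1 - q * x\<^sup>2"
    using one_minus_square_pos one_minus_q_square_pos assms by auto
  define w R where "w = jacobi_weight \<alpha> x" and "R = amplitude \<alpha> q x"
  have R: "R\<^sup>2 = (1 - x\<^sup>2) * (1 - q * x\<^sup>2) * w\<^sup>2"
    using p by (simp add: R_def amplitude_def w_def power_mult_distrib)
  have F2: "((\<lambda>t. (jacobi_weight \<alpha> t * (1 - t\<^sup>2) * z t)\<^sup>2) has_real_derivative
      2 * ((- \<mu> * w * (1 - q * x\<^sup>2) * y x) * (w * (1 - x\<^sup>2) * z x))) (at x)"
    using DERIV_power[OF flux_deriv[OF assms], of 2] by (simp add: w_def)
  have R2: "((\<lambda>t. (amplitude \<alpha> q t)\<^sup>2) has_real_derivative 4 * log_slope \<alpha> q x * R\<^sup>2) (at x)"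
    using DERIV_power[OF amplitude_has_derivative[OF assms p(2), of \<alpha>], of 2]
    by (simp add: R_def power2_eq_square mult_ac)
  have y2: "((\<lambda>t. (y t)\<^sup>2) has_real_derivative 2 * (z x * y x)) (at x)"
    using DERIV_power[OF y_deriv[OF assms], of 2] by simp
  have "(energy has_real_derivative
      2 * ((- \<mu> * w * (1 - q * x\<^sup>2) * y x) * (w * (1 - x\<^sup>2) * z x))
      + (\<mu> * (4 * log_slope \<alpha> q x * R\<^sup>2) * (y x)\<^sup>2 + 2 * (z x * y x) * (\<mu> * R\<^sup>2))) (at x)"
    unfolding energy_def[abs_def] R_def[symmetric]
    using DERIV_add[OF F2 DERIV_mult[OF DERIV_cmult[OF R2, of \<mu>] y2]] by (simp add: R_def)
  moreover have "4 * log_slope \<alpha> q x * R\<^sup>2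
      = - (2 * x * ((2 * \<alpha> + 1) * (1 - q * x\<^sup>2) + q * (1 - x\<^sup>2)) * w\<^sup>2)"
    unfolding R log_slope_def using p by (simp add: divide_simps) algebra
  then have "2 * ((- \<mu> * w * (1 - q * x\<^sup>2) * y x) * (w * (1 - x\<^sup>2) * z x))
      + (\<mu> * (4 * log_slope \<alpha> q x * R\<^sup>2) * (y x)\<^sup>2 + 2 * (z x * y x) * (\<mu> * R\<^sup>2))
      = - (2 * \<mu> * x * ((2 * \<alpha> + 1) * (1 - q * x\<^sup>2) + q * (1 - x\<^sup>2)) * w\<^sup>2 * (y x)\<^sup>2)"
    unfolding R by algebra
  ultimately show ?thesis
    by (simp add: w_def)
qed

text \<open>
  One factor \<open>\<omega> \<le> 1\<close> is given up. The remaining estimate is \<open>x * ((1 - q * x\<^sup>2) + q * (1 - x\<^sup>2)) \<le> 1\<close>,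
  which holds because \<open>q * x * (1 - 2 * x\<^sup>2) \<le> 2 * q * (1 - x) \<le> 1 - x\<close>.
\<close>
lemma energy_dissipation_le:
  assumes "0 \<le> x" "x < 1"
  shows "2 * \<mu> * x * ((2 * \<alpha> + 1) * (1 - q * x\<^sup>2) + q * (1 - x\<^sup>2)) * (jacobi_weight \<alpha> x)\<^sup>2 * (y x)\<^sup>2
    \<le> (4 * \<alpha> + 2) * \<mu> * ((y x)\<^sup>2 * jacobi_weight \<alpha> x)"
proof -
  have p: "0 < 1 - x\<^sup>2" "0 < 1 - q * x\<^sup>2" "0 < jacobi_weight \<alpha> x" "jacobi_weight \<alpha> x \<le> 1"
    using one_minus_square_pos[of x] one_minus_q_square_pos[of x] assms jacobi_weight_pos[of x \<alpha>]
      jacobi_weight_le_1[of \<alpha> x] alpha_bounds by auto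
  have "q * x * (1 - 2 * x\<^sup>2) \<le> q * (x * (1 - x\<^sup>2))"
    using assms q_bounds by (simp add: algebra_simps)
  also have "x * (1 - x\<^sup>2) = x * (1 + x) * (1 - x)"
    by (simp add: algebra_simps power2_eq_square)
  also have "q * (x * (1 + x) * (1 - x)) \<le> q * (1 * 2 * (1 - x))"
    using assms q_bounds by (intro mult_left_mono mult_right_mono mult_mono) auto
  also have "\<dots> \<le> 1 - x"
    using mult_right_mono[of "2 * q" 1 "1 - x"] assms q_bounds by (simp add: algebra_simps)
  finally have "x * ((1 - q * x\<^sup>2) + q * (1 - x\<^sup>2)) \<le> 1"
    by (simp add: algebra_simps)
  moreover have "x * ((2 * \<alpha> + 1) * (1 - q * x\<^sup>2) + q * (1 - x\<^sup>2))
      \<le> (2 * \<alpha> + 1) * (x * ((1 - q * x\<^sup>2) + q * (1 - x\<^sup>2)))"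
  proof -
    have "0 \<le> 2 * \<alpha> * (x * (q * (1 - x\<^sup>2)))"
      using assms p alpha_bounds q_bounds by simp
    then show ?thesis
      by (simp add: algebra_simps)
  qed
  moreover have "(2 * \<alpha> + 1) * (x * ((1 - q * x\<^sup>2) + q * (1 - x\<^sup>2))) \<le> (2 * \<alpha> + 1) * 1"
    using calculation(1) alpha_bounds by (intro mult_left_mono) auto
  ultimately have 1: "x * ((2 * \<alpha> + 1) * (1 - q * x\<^sup>2) + q * (1 - x\<^sup>2)) \<le> 2 * \<alpha> + 1"
    unfolding mult_1_right by (meson order_trans)
  have 2: "(jacobi_weight \<alpha> x)\<^sup>2 \<le> jacobi_weight \<alpha> x"
    using p by (simp add: power2_eq_square mult_left_le)
  have "x * ((2 * \<alpha> + 1) * (1 - q * x\<^sup>2) + q * (1 - x\<^sup>2)) * (jacobi_weight \<alpha> x)\<^sup>2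
    \<le> (2 * \<alpha> + 1) * jacobi_weight \<alpha> x"
    using 1 2 p alpha_bounds by (intro mult_mono) auto
  from mult_left_mono[OF this, of "2 * \<mu> * (y x)\<^sup>2"] show ?thesis
    using mu_pos by (simp add: algebra_simps)
qed

text \<open>
  The flux compares \<open>z\<close> with \<open>1 / (1 - x)\<close>, the derivative of \<open>- ln (1 - x)\<close>. Between \<open>s\<close> and a point \<open>r\<close>
  sufficiently close to 1 the logarithm grows by any prescribed amount \<open>K\<close>, while \<open>y\<close> changes by at
  most twice its bound; Cauchy's mean value theorem then yields an intermediate point with small flux.
\<close>
lemma flux_small_near_1:
  assumes "0 \<le> s" "s < 1" "0 < e"
  shows "\<exists>x. s < x \<and> x < 1 \<and> \<bar>jacobi_weight \<alpha> x * (1 - x\<^sup>2) * z x\<bar> < e"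
proof -
  obtain M where M: "\<And>x. -1 < x \<Longrightarrow> x < 1 \<Longrightarrow> \<bar>y x\<bar> \<le> M"
    using bounded by (metis greaterThanLessThan_iff)
  have M0: "0 \<le> M"
    using M[of 0] by simp
  define K where "K = 4 * M / e + 1"
  have K: "0 < K" "4 * M < e * K"
    using M0 assms by (auto simp: K_def field_simps add_nonneg_pos)
  define r where "r = 1 - (1 - s) * exp (- K)"
  have "0 < (1 - s) * (1 - exp (- K))" "0 < (1 - s) * exp (- K)"
    using assms K by (intro mult_pos_pos; simp)+
  then have r: "s < r" "r < 1"
    unfolding r_def by (simp_all only: algebra_simps)
  have gd: "((\<lambda>t. - ln (1 - t)) has_real_derivative 1 / (1 - t)) (at t)" if "t < 1" for t :: real
    using that by (auto intro!: derivative_eq_intros)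
  have "\<exists>x. s < x \<and> x < r \<and> (- ln (1 - r) - - ln (1 - s)) * z x = (y r - y s) * (1 / (1 - x))"
  proof (rule GMVT'[of s r "\<lambda>t. - ln (1 - t)" y z "\<lambda>t. 1 / (1 - t)"])
    show "isCont (\<lambda>t. - ln (1 - t)) t" if "s \<le> t" "t \<le> r" for t
      using DERIV_isCont[OF gd[of t]] that r by simp
    show "isCont y t" if "s \<le> t" "t \<le> r" for t
      using DERIV_isCont[OF y_deriv[of t]] that r assms by simp
  qed (use gd y_deriv r assms in auto)
  then obtain x where x: "s < x" "x < r"
    and eq: "(- ln (1 - r) - - ln (1 - s)) * z x = (y r - y s) * (1 / (1 - x))"
    by blast
  have lg: "- ln (1 - r) - - ln (1 - s) = K"
    using assms by (simp add: r_def ln_mult)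
  then have eq': "K * ((1 - x) * z x) = y r - y s"
    using eq[unfolded lg] x r by (simp add: field_simps)
  have xx: "-1 < x" "x < 1" "0 \<le> x"
    using x r assms by auto
  have w: "0 < jacobi_weight \<alpha> x" "jacobi_weight \<alpha> x \<le> 1"
    using jacobi_weight_pos jacobi_weight_le_1 alpha_bounds xx by auto
  have "K * \<bar>jacobi_weight \<alpha> x * (1 - x\<^sup>2) * z x\<bar> = jacobi_weight \<alpha> x * (1 + x) * \<bar>K * ((1 - x) * z x)\<bar>"
  proof -
    have "1 - x\<^sup>2 = (1 + x) * (1 - x)"
      by (simp add: algebra_simps power2_eq_square)
    then show ?thesis
      using K w xx by (simp add: abs_mult mult_ac)
  qed
  also have "\<dots> \<le> (1 * 2) * (2 * M)"
    unfolding eq' using w xx M[of r] M[of s] r assms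
    by (intro mult_mono) auto
  also have "\<dots> < K * e"
    using K by (simp add: mult.commute)
  finally show ?thesis
    using K x r by (intro exI[of _ x]) auto
qed

text \<open>
  It suffices to compare the energy at 0 with its value at points near 1 where the flux is small,
  so the energy need not be shown to converge at 1.
\<close>
lemma energy_le_mass:
  assumes int: "(\<lambda>x. (y x)\<^sup>2 * jacobi_weight \<alpha> x) integrable_on {0..1}"
  shows "(z 0)\<^sup>2 + \<mu> * (y 0)\<^sup>2
    \<le> (4 * \<alpha> + 2) * \<mu> * integral {0..1} (\<lambda>x. (y x)\<^sup>2 * jacobi_weight \<alpha> x)"
    (is "_ \<le> ?C * integral _ ?g")
proof -
  have C: "0 \<le> ?C"
    using alpha_bounds mu_pos by simp
  have E0: "energy 0 = (z 0)\<^sup>2 + \<mu> * (y 0)\<^sup>2"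
    by (simp add: energy_def amplitude_def jacobi_weight_def)
  have drop: "energy 0 \<le> energy x + ?C * integral {0..1} ?g" if x: "0 \<le> x" "x < 1" for x
  proof -
    define E' where "E' = (\<lambda>x. - (2 * \<mu> * x * ((2 * \<alpha> + 1) * (1 - q * x\<^sup>2) + q * (1 - x\<^sup>2))
      * (jacobi_weight \<alpha> x)\<^sup>2 * (y x)\<^sup>2))"
    have "(E' has_integral energy x - energy 0) {0..x}"
    proof (rule fundamental_theorem_of_calculus[OF x(1)])
      fix t assume "t \<in> {0..x}"
      then have "(energy has_real_derivative E' t) (at t)"
        unfolding E'_def using x by (intro energy_deriv) auto
      then show "(energy has_vector_derivative E' t) (at t within {0..x})"
        by (simp add: has_real_derivative_iff_has_vector_derivative has_vector_derivative_at_within)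
    qed
    moreover have gx: "?g integrable_on {0..x}"
      using integrable_subinterval_real[OF int] x by auto
    then have "((\<lambda>t. - ?C * ?g t) has_integral - ?C * integral {0..x} ?g) {0..x}"
      by (intro has_integral_mult_right integrable_integral)
    ultimately have "- ?C * integral {0..x} ?g \<le> energy x - energy 0"
      using energy_dissipation_le x by (elim has_integral_le[rotated]) (auto simp: E'_def)
    moreover have "integral {0..x} ?g \<le> integral {0..1} ?g"
      using x by (intro integral_subset_le gx int) (auto simp: jacobi_weight_def)
    ultimately show ?thesis
      using mult_left_mono[OF _ C, of "integral {0..x} ?g" "integral {0..1} ?g"] by simp
  qed
  obtain M where M: "\<And>x. -1 < x \<Longrightarrow> x < 1 \<Longrightarrow> \<bar>y x\<bar> \<le> M"
    using bounded by (metis greaterThanLessThan_iff)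
  have "energy 0 \<le> ?C * integral {0..1} ?g + e" if e: "0 < e" for e
  proof -
    \<comment> \<open>Within distance \<open>d\<close> of 1 the second summand of the energy is at most \<open>e / 2\<close>, as
      \<open>amplitude\<^sup>2 \<le> 1 - x\<^sup>2 \<le> 2 * d\<close>; adding 1 to \<open>M\<^sup>2\<close> keeps the denominator nonzero.\<close>
    define d where "d = e / (4 * \<mu> * (M\<^sup>2 + 1))"
    have d: "0 < d"
      using e mu_pos by (auto simp: d_def intro!: divide_pos_pos mult_pos_pos add_nonneg_pos)
    have "0 \<le> max 0 (1 - d)" "max 0 (1 - d) < 1" "0 < sqrt (e / 2)"
      using d e by auto
    from flux_small_near_1[OF this] obtain x where x: "max 0 (1 - d) < x" "x < 1"
      and F: "\<bar>jacobi_weight \<alpha> x * (1 - x\<^sup>2) * z x\<bar> < sqrt (e / 2)"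
      by blast
    have xx: "0 \<le> x" "-1 < x" "1 - x < d"
      using x by auto
    have "(jacobi_weight \<alpha> x * (1 - x\<^sup>2) * z x)\<^sup>2 \<le> (sqrt (e / 2))\<^sup>2"
      using F by (intro abs_le_square_iff[THEN iffD1]) auto
    then have 1: "(jacobi_weight \<alpha> x * (1 - x\<^sup>2) * z x)\<^sup>2 \<le> e / 2"
      using e by simp
    have p: "0 < 1 - x\<^sup>2" "0 < 1 - q * x\<^sup>2"
      using one_minus_square_pos[of x] one_minus_q_square_pos[of x] x by auto
    have w: "0 < jacobi_weight \<alpha> x" "jacobi_weight \<alpha> x \<le> 1"
      using jacobi_weight_pos jacobi_weight_le_1 alpha_bounds xx x by auto
    have "(amplitude \<alpha> q x)\<^sup>2 = (1 - x\<^sup>2) * ((1 - q * x\<^sup>2) * (jacobi_weight \<alpha> x)\<^sup>2)"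
      using p by (simp add: amplitude_def power_mult_distrib)
    also have "\<dots> \<le> (1 - x\<^sup>2) * (1 * 1)"
      using p w q_bounds by (intro mult_left_mono mult_mono) (auto simp: power_le_one)
    also have "\<dots> = (1 + x) * (1 - x)"
      by (simp add: algebra_simps power2_eq_square)
    also have "\<dots> \<le> 2 * d"
      using xx x by (intro mult_mono) auto
    finally have "(amplitude \<alpha> q x)\<^sup>2 \<le> 2 * d" .
    moreover have "(y x)\<^sup>2 \<le> M\<^sup>2 + 1"
      using abs_le_square_iff[THEN iffD1, of "y x" M] M[of x] xx x by simp
    ultimately have "\<mu> * (amplitude \<alpha> q x)\<^sup>2 * (y x)\<^sup>2 \<le> \<mu> * (2 * d) * (M\<^sup>2 + 1)"
      using mu_pos d by (intro mult_mono mult_left_mono) auto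
    also have "\<dots> = e / 2"
    proof -
      have "M\<^sup>2 + 1 \<noteq> 0"
        by (metis add.commute power_one sum_power2_eq_zero_iff zero_neq_one)
      then show ?thesis
        using mu_pos by (simp add: d_def divide_simps)
    qed
    finally have "energy x \<le> e"
      using 1 by (simp add: energy_def)
    then show ?thesis
      using drop[of x] xx x by simp
  qed
  then have "energy 0 \<le> ?C * integral {0..1} ?g"
    by (rule field_le_epsilon)
  then show ?thesis
    by (simp add: E0)
qed

end

section \<open>The bounds for the normalized eigenfunction\<close>

theorem lemma2:
  fixes \<alpha> c q A :: real and n :: nat and \<psi> :: "real \<Rightarrow> real"
  assumes "0 \<le> \<alpha>" and "\<alpha> \<le> 1/4" and "c > 0"
    and "is_gpswf \<alpha> c n \<psi>"
    and "q = c\<^sup>2 / chi \<alpha> c n" and "0 < q" and "q < 3/17"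
    and "A\<^sup>2 = \<bar>\<psi> 0\<bar>\<^sup>2 + \<bar>deriv \<psi> 0\<bar>\<^sup>2 / chi \<alpha> c n"
  shows "(SUP x\<in>{0..1}. sqrt ((1 - x\<^sup>2) * (1 - q * x\<^sup>2)) * jacobi_weight \<alpha> x * \<bar>\<psi> x\<bar>\<^sup>2) \<le> A\<^sup>2
         \<and> A\<^sup>2 \<le> 2 * \<alpha> + 1"
proof
  define \<mu> where "\<mu> = chi \<alpha> c n"
  have mu: "0 < \<mu>" and c: "c\<^sup>2 = q * \<mu>"
    using assms(3,5,6) by (auto simp: \<mu>_def zero_less_divide_iff field_simps)
  have ef: "bounded_eigenfunction \<alpha> c \<mu> \<psi>"
    and norm: "((\<lambda>x. (\<psi> x)\<^sup>2 * jacobi_weight \<alpha> x) has_integral 1) {-1..1}"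
    using assms(4) by (auto simp: is_gpswf_def \<mu>_def)
  interpret regular_solution \<alpha> q \<mu> \<psi> "deriv \<psi>"
  proof
    fix x :: real
    assume x: "-1 < x" "x < 1"
    have at: "at x within {-1<..<1} = at x"
      using x by (intro at_within_open) auto
    have "\<psi> differentiable (at x)"
      using ef x at unfolding bounded_eigenfunction_def differentiable_on_def
      by (metis greaterThanLessThan_iff)
    then show "(\<psi> has_real_derivative deriv \<psi> x) (at x)"
      by (metis DERIV_imp_deriv real_differentiable_def)
    let ?F = "\<lambda>t. jacobi_weight \<alpha> t * (1 - t\<^sup>2) * deriv \<psi> t"
    have "?F differentiable (at x)"
      using ef x at unfolding bounded_eigenfunction_def differentiable_on_def
      by (metis greaterThanLessThan_iff)
    then have "(?F has_real_derivative deriv ?F x) (at x)"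
      by (metis DERIV_imp_deriv real_differentiable_def)
    moreover have "deriv ?F x = - \<mu> * jacobi_weight \<alpha> x * (1 - q * x\<^sup>2) * \<psi> x"
    proof -
      have "- (1 / jacobi_weight \<alpha> x) * deriv ?F x + q * \<mu> * x\<^sup>2 * \<psi> x = \<mu> * \<psi> x"
        using ef x unfolding bounded_eigenfunction_def sturm_liouville_op_def c by auto
      then show ?thesis
        using jacobi_weight_pos[OF x, of \<alpha>] by (simp add: field_simps)
    qed
    ultimately show "(?F has_real_derivative - \<mu> * jacobi_weight \<alpha> x * (1 - q * x\<^sup>2) * \<psi> x) (at x)"
      by simp
  next
    obtain M where "\<forall>v\<in>\<psi> ` {-1..1}. norm v \<le> M"
      using ef unfolding bounded_eigenfunction_def bounded_iff by blast
    then show "\<exists>M. \<forall>x\<in>{-1<..<1}. \<bar>\<psi> x\<bar> \<le> M"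
      by (intro exI[of _ M]) auto
  qed (use assms mu in auto)
  interpret reflected: regular_solution \<alpha> q \<mu> "\<lambda>x. \<psi> (- x)" "\<lambda>x. - deriv \<psi> (- x)"
    by (rule reflection)
  have A: "A\<^sup>2 = (\<psi> 0)\<^sup>2 + (deriv \<psi> 0)\<^sup>2 / \<mu>"
    using assms(8) by (simp add: \<mu>_def)
  have muA: "\<mu> * A\<^sup>2 = (deriv \<psi> 0)\<^sup>2 + \<mu> * (\<psi> 0)\<^sup>2"
    using mu by (simp add: A distrib_left)
  have A_nonneg: "0 \<le> A\<^sup>2"
    by simp
  show "(SUP x\<in>{0..1}. sqrt ((1 - x\<^sup>2) * (1 - q * x\<^sup>2)) * jacobi_weight \<alpha> x * \<bar>\<psi> x\<bar>\<^sup>2) \<le> A\<^sup>2"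
  proof (rule cSUP_least)
    fix x :: real
    assume "x \<in> {0..1}"
    then consider "0 \<le> x" "x < 1" | "x = 1"
      by fastforce
    then show "sqrt ((1 - x\<^sup>2) * (1 - q * x\<^sup>2)) * jacobi_weight \<alpha> x * \<bar>\<psi> x\<bar>\<^sup>2 \<le> A\<^sup>2"
    proof cases
      case 1
      then show ?thesis
        using amplitude_square_le[of x] A by (simp add: amplitude_def)
    qed (use A_nonneg in simp)
  qed simp
  let ?g = "\<lambda>x. (\<psi> x)\<^sup>2 * jacobi_weight \<alpha> x"
  have int: "?g integrable_on {-1..1}"
    using norm by blast
  have right: "?g integrable_on {0..1}" and left: "?g integrable_on {-1..0}"
    using integrable_subinterval_real[OF int] by auto
  have reflect: "integral {0..1} (\<lambda>x. (\<psi> (- x))\<^sup>2 * jacobi_weight \<alpha> x) = integral {-1..0} ?g"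
    using Henstock_Kurzweil_Integration.integral_reflect_real[where f = ?g and a = "-1" and b = 0]
    unfolding jacobi_weight_even minus_minus minus_zero .
  have "(\<lambda>x. (\<psi> (- x))\<^sup>2 * jacobi_weight \<alpha> x) integrable_on {0..1}"
    using Henstock_Kurzweil_Integration.integrable_reflect_real[where f = ?g and a = "-1" and b = 0] left
    by (simp add: jacobi_weight_even)
  from reflected.energy_le_mass[OF this]
  have "\<mu> * A\<^sup>2 \<le> (4 * \<alpha> + 2) * \<mu> * integral {-1..0} ?g"
    unfolding muA reflect by simp
  moreover have "\<mu> * A\<^sup>2 \<le> (4 * \<alpha> + 2) * \<mu> * integral {0..1} ?g"
    unfolding muA by (rule energy_le_mass[OF right])
  ultimately have "2 * (\<mu> * A\<^sup>2)
      \<le> (4 * \<alpha> + 2) * \<mu> * (integral {-1..0} ?g + integral {0..1} ?g)"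
    unfolding distrib_left[of "(4 * \<alpha> + 2) * \<mu>"] by linarith
  moreover have "integral {-1..0} ?g + integral {0..1} ?g = 1"
    using Henstock_Kurzweil_Integration.integral_combine[OF _ _ int, of 0] integral_unique[OF norm]
    by simp
  ultimately have "\<mu> * (2 * A\<^sup>2) \<le> \<mu> * (4 * \<alpha> + 2)"
    by (simp add: mult_ac)
  then show "A\<^sup>2 \<le> 2 * \<alpha> + 1"
    using mu by simp
qed

end
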